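(* Let $k\ge 3$ and let $n$ be a positive integer. If there exists a realizable $n_k$-configuration, then $n>k^2+k-5$. In particular, there is no realizable $15_4$-configuration.
   Context: For $k\geq 3$, an $n_k$-configuration is a simple matroid $M$ of rank $3$ on $n$ elements (called points) such that every line (rank-2 flat) of $M$ contains at most $k$ points, and each point is contained in exactly $k$ lines that have exactly $k$ points. An $n_k$-configuration $M$ is realizable if it can be drawn with straight lines in the real projective plane with exactly the prescribed incidences, i.e. if $M$ is representable over $\mathbb{R}$: there are $n$ distinct points in the real projective plane, labelled by the elements of $M$, such that a set of these points is collinear if and only if the corresponding set of elements has rank at most $2$ in $M$. (Equivalently, by polarity, there are $n$ distinct lines labelled by the elements of $M$ such that a set of them has a common point if and only if the corresponding set of elements has rank at most $2$ in $M$.) *)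

theory Defs
  imports "HOL-Analysis.Analysis"
begin

locale matroid =
  fixes E :: "'a set" and indep :: "'a set \<Rightarrow> bool"
  assumes finite_ground: "finite E"
    and indep_subset_ground: "indep I \<Longrightarrow> I \<subseteq> E"
    and indep_empty: "indep {}"
    and indep_subset: "indep I \<Longrightarrow> J \<subseteq> I \<Longrightarrow> indep J"
    and augment: "indep I \<Longrightarrow> indep J \<Longrightarrow> card J < card I \<Longrightarrow>
      \<exists>x \<in> I - J. indep (insert x J)"
begin

definition rank :: "'a set \<Rightarrow> nat" where
  "rank X = Max (card ` {I. I \<subseteq> X \<and> indep I})"

definition flat :: "'a set \<Rightarrow> bool" where
  "flat F \<longleftrightarrow> F \<subseteq> E \<and> (\<forall>x \<in> E - F. rank F < rank (insert x F))"

definition line :: "'a set \<Rightarrow> bool" where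
  "line L \<longleftrightarrow> flat L \<and> rank L = 2"

end

locale simple_matroid = matroid +
  assumes no_loops: "x \<in> E \<Longrightarrow> indep {x}"
    and no_parallel: "x \<in> E \<Longrightarrow> y \<in> E \<Longrightarrow> x \<noteq> y \<Longrightarrow> indep {x, y}"

locale nk_configuration = simple_matroid E indep
  for E :: "'a set" and indep :: "'a set \<Rightarrow> bool" and n k :: nat +
  assumes card_ground: "card E = n"
    and rank_ground: "rank E = 3"
    and card_line_le: "line L \<Longrightarrow> card L \<le> k"
    and card_full_lines: "x \<in> E \<Longrightarrow> card {L. line L \<and> x \<in> L \<and> card L = k} = k"

text \<open>The points and lines of the real projective plane are the linear subspaces of
  dimension 1 and 2 of \<open>\<real>\<^sup>3\<close>; incidence is inclusion.\<close>

definition proj_points :: "(real ^ 3) set set" where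
  "proj_points = {P. subspace P \<and> dim P = 1}"

definition proj_lines :: "(real ^ 3) set set" where
  "proj_lines = {L. subspace L \<and> dim L = 2}"

definition proj_collinear :: "(real ^ 3) set set \<Rightarrow> bool" where
  "proj_collinear A \<longleftrightarrow> (\<exists>L \<in> proj_lines. \<forall>P \<in> A. P \<subseteq> L)"

definition (in matroid) realizable :: bool where
  "realizable \<longleftrightarrow> (\<exists>p. inj_on p E \<and> p ` E \<subseteq> proj_points \<and>
    (\<forall>S \<subseteq> E. proj_collinear (p ` S) \<longleftrightarrow> rank S \<le> 2))"

end

theory Submission
  imports Defs
begin

text \<open>In a realization, counting pairs of points on lines and applying the weak form
  \<open>\<Sum>\<^sub>L (3 - |L|) > 0\<close> of Melchior's inequality, the sum being over all lines spanned by the points, gives the bound,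
  because \<open>j (j - 1) - 2 (3 - j) \<ge> 0\<close> for \<open>j \<ge> 2\<close> and there are \<open>n\<close> lines with \<open>j = k\<close>.

  This inequality is obtained without Euler's formula. A pair of neighbouring points \<open>p\<close>, \<open>q\<close>
  on a spanned line determines a cut of the point set: rotate the line slightly counterclockwise
  about a point between them. The cut determines the ordered pair, so there are
  \<open>2 \<Sum>\<^sub>L (|L| - 1)\<close> such parts. Rotating further, about \<open>p\<close> or about \<open>q\<close>, one reaches a
  spanned line all of whose points lie in a single part, so that every part is an open or closed
  side of a spanned line. Each line has four such sides, and the sides \<open>{}\<close> and \<open>S\<close> of a
  supporting line are not parts of cuts.\<close>

section \<open>Orientation of point triples\<close>

text \<open>Twice the signed area of the triangle \<open>a\<close>, \<open>b\<close>,
  \<open>r\<close>: an affine function of \<open>r\<close>, positive to the left of the line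
  directed from \<open>a\<close> to \<open>b\<close>.\<close>

definition orient :: "real \<times> real \<Rightarrow> real \<times> real \<Rightarrow> real \<times> real \<Rightarrow> real" where
  "orient a b r = (fst b - fst a) * (snd r - snd a) - (snd b - snd a) * (fst r - fst a)"

lemma orient_swap: "orient b a r = - orient a b r"
  by (simp add: orient_def algebra_simps)

lemma orient_flip: "orient a r b = - orient a b r"
  by (simp add: orient_def algebra_simps)

lemma orient_self [simp]: "orient a b a = 0" "orient a b b = 0" "orient a a b = 0"
  by (simp_all add: orient_def algebra_simps)

text \<open>The two differences are the cross products of \<open>q' - p'\<close> with
  \<open>q - p\<close> and of \<open>q - p\<close> with \<open>q' - p'\<close>, which cancel by
  antisymmetry. When all four signed terms have the same weak sign, each must vanish; this is how
  two separating lines are compared.\<close>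

lemma orient_exchange:
  "orient p' q' q - orient p' q' p + orient p q q' - orient p q p' = 0"
  by (simp add: orient_def algebra_simps)

text \<open>This is the cross product of \<open>r - p\<close> and \<open>x - p\<close>, computed in
  the orthogonal frame formed by \<open>q - p\<close> and its quarter turn.\<close>

lemma orient_triple_inner:
  "(q - p) \<bullet> (q - p) * orient p r x
    = (q - p) \<bullet> (r - p) * orient p q x - orient p q r * ((q - p) \<bullet> (x - p))"
  by (simp add: orient_def inner_prod_def algebra_simps)

text \<open>A point of the line is its own orthogonal projection, so \<open>t\<close> is the
  projection coefficient of \<open>r - a\<close> on \<open>b - a\<close>.\<close>

lemma on_line_parameter:
  assumes "a \<noteq> b" "orient a b r = 0"
  obtains t where "r = a + t *\<^sub>R (b - a)"
proof -
  define d e where "d = b - a" and "e = r - a"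
  define t where "t = inverse (d \<bullet> d) * (d \<bullet> e)"
  have pos: "d \<bullet> d \<noteq> 0" using assms(1) by (simp add: d_def)
  have *: "fst d * snd e = snd d * fst e"
    using assms(2) by (simp add: orient_def d_def e_def)
  have "(d \<bullet> d) *\<^sub>R e = (d \<bullet> e) *\<^sub>R d"
  proof (rule prod_eqI)
    have "(fst d * fst d + snd d * snd d) * fst e = (fst d * fst e + snd d * snd e) * fst d"
      using * by algebra
    then show "fst ((d \<bullet> d) *\<^sub>R e) = fst ((d \<bullet> e) *\<^sub>R d)" by (simp add: inner_prod_def)
    have "(fst d * fst d + snd d * snd d) * snd e = (fst d * fst e + snd d * snd e) * snd d"
      using * by algebra
    then show "snd ((d \<bullet> d) *\<^sub>R e) = snd ((d \<bullet> e) *\<^sub>R d)" by (simp add: inner_prod_def)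
  qed
  then have "inverse (d \<bullet> d) *\<^sub>R ((d \<bullet> d) *\<^sub>R e) = t *\<^sub>R d" by (simp add: t_def)
  then have "e = t *\<^sub>R d" using pos by simp
  then have "r = a + t *\<^sub>R (b - a)" unfolding d_def e_def by (metis add.commute diff_add_cancel)
  then show thesis by (rule that)
qed

text \<open>The factor is the difference of the line parameters of \<open>d\<close> and
  \<open>c\<close>; its sign tells whether the direction is preserved or reversed.\<close>

lemma orient_proportional:
  assumes "a \<noteq> b" "c \<noteq> d" "orient a b c = 0" "orient a b d = 0"
  obtains l where "l \<noteq> 0" "\<And>r. orient c d r = l * orient a b r"
proof -
  obtain s where s: "c = a + s *\<^sub>R (b - a)" using assms on_line_parameter by metis
  obtain t where t: "d = a + t *\<^sub>R (b - a)" using assms on_line_parameter by metis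
  have "orient c d r = (t - s) * orient a b r" for r
    by (simp add: s t orient_def algebra_simps)
  moreover have "t - s \<noteq> 0" using assms(2) s t by auto
  ultimately show thesis using that by blast
qed

section \<open>Lines spanned by a point set\<close>

definition spanned_line :: "(real \<times> real) set \<Rightarrow> real \<times> real \<Rightarrow> real \<times> real \<Rightarrow> (real \<times> real) set"
  where "spanned_line S a b = {r \<in> S. orient a b r = 0}"

definition spanned_lines :: "(real \<times> real) set \<Rightarrow> (real \<times> real) set set"
  where "spanned_lines S = {spanned_line S a b |a b. a \<in> S \<and> b \<in> S \<and> a \<noteq> b}"

lemma spanned_line_eq:
  assumes "a \<noteq> b" "c \<noteq> d" "c \<in> spanned_line S a b" "d \<in> spanned_line S a b"
  shows "spanned_line S c d = spanned_line S a b"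
proof -
  have "orient a b c = 0" "orient a b d = 0" using assms(3,4) by (simp_all add: spanned_line_def)
  then obtain l where "l \<noteq> 0" "\<And>r. orient c d r = l * orient a b r"
    using orient_proportional[OF assms(1,2)] by metis
  then show ?thesis by (simp add: spanned_line_def)
qed

lemma spanned_lines_eq:
  assumes "L \<in> spanned_lines S" "a \<in> L" "b \<in> L" "a \<noteq> b"
  shows "L = spanned_line S a b"
proof -
  obtain c d where "c \<noteq> d" "L = spanned_line S c d"
    using assms(1) unfolding spanned_lines_def by blast
  then show ?thesis using spanned_line_eq assms(2-4) by metis
qed

lemma spanned_line_in_lines:
  "a \<in> S \<Longrightarrow> b \<in> S \<Longrightarrow> a \<noteq> b \<Longrightarrow> spanned_line S a b \<in> spanned_lines S"
  unfolding spanned_lines_def by blast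

lemma spanned_lines_subset: "L \<in> spanned_lines S \<Longrightarrow> L \<subseteq> S"
  by (auto simp: spanned_lines_def spanned_line_def)

lemma finite_spanned_lines: "finite S \<Longrightarrow> finite (spanned_lines S)"
  by (rule finite_subset[of _ "Pow S"]) (use spanned_lines_subset in auto)

lemma spanned_lines_card:
  assumes "finite S" "L \<in> spanned_lines S" shows "card L \<ge> 2"
proof -
  obtain a b where ab: "a \<in> S" "b \<in> S" "a \<noteq> b" "L = spanned_line S a b"
    using assms(2) by (auto simp: spanned_lines_def)
  then have "{a, b} \<subseteq> L" by (auto simp: spanned_line_def)
  then have "card {a, b} \<le> card L"
    using assms spanned_lines_subset finite_subset card_mono by metis
  then show ?thesis using ab(3) by simp
qed

text \<open>Two distinct points lie on only one spanned line, so the sets \<open>P L\<close> are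
  disjoint. \<open>P\<close> stays general because both all ordered pairs and the adjacent ones are
  counted this way.\<close>

lemma sum_card_pairs_on_lines:
  assumes "finite S" "\<And>L. L \<in> spanned_lines S \<Longrightarrow> P L \<subseteq> {(a, b). a \<in> L \<and> b \<in> L \<and> a \<noteq> b}"
  shows "(\<Sum>L\<in>spanned_lines S. card (P L)) = card (\<Union>L\<in>spanned_lines S. P L)"
proof (rule card_UN_disjoint[symmetric])
  show "finite (spanned_lines S)" by (rule finite_spanned_lines[OF assms(1)])
  show "\<forall>L\<in>spanned_lines S. finite (P L)"
  proof
    fix L assume L: "L \<in> spanned_lines S"
    have "P L \<subseteq> S \<times> S" using assms(2)[OF L] spanned_lines_subset[OF L] by auto
    then show "finite (P L)" using assms(1) finite_subset by blast
  qed
  show "\<forall>L\<in>spanned_lines S. \<forall>M\<in>spanned_lines S. L \<noteq> M \<longrightarrow> P L \<inter> P M = {}"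
  proof (intro ballI impI, rule ccontr)
    fix L M assume LM: "L \<in> spanned_lines S" "M \<in> spanned_lines S" "L \<noteq> M" "P L \<inter> P M \<noteq> {}"
    then obtain a b where "(a, b) \<in> P L" "(a, b) \<in> P M" by auto
    then have "a \<in> L" "b \<in> L" "a \<in> M" "b \<in> M" "a \<noteq> b" using assms(2) LM by blast+
    then show False using spanned_lines_eq LM by metis
  qed
qed

lemma sum_ordered_pairs_le:
  assumes "finite S"
  shows "(\<Sum>L\<in>spanned_lines S. int (card L) * (int (card L) - 1)) \<le> int (card S) * (int (card S) - 1)"
proof -
  let ?P = "\<lambda>L. {(a, b). a \<in> L \<and> b \<in> L \<and> a \<noteq> b} :: ((real \<times> real) \<times> real \<times> real) set"
  have c: "int (card (?P L)) = int (card L) * (int (card L) - 1)" if "finite L" for L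
  proof -
    have e: "?P L = (SIGMA a:L. L - {a})" by auto
    have "card (?P L) = (\<Sum>a\<in>L. card L - 1)"
      unfolding e using that by (subst card_SigmaI) auto
    then show ?thesis by (cases "card L") (auto simp: algebra_simps)
  qed
  have "(\<Sum>L\<in>spanned_lines S. card (?P L)) = card (\<Union>L\<in>spanned_lines S. ?P L)"
    by (rule sum_card_pairs_on_lines[OF assms]) auto
  also have "\<dots> \<le> card (?P S)"
  proof (rule card_mono)
    show "finite (?P S)" by (rule finite_subset[of _ "S \<times> S"]) (use assms in auto)
    show "(\<Union>L\<in>spanned_lines S. ?P L) \<subseteq> ?P S" using spanned_lines_subset by blast
  qed
  finally have "int (\<Sum>L\<in>spanned_lines S. card (?P L)) \<le> int (card (?P S))" by (rule of_nat_mono)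
  moreover have "int (\<Sum>L\<in>spanned_lines S. card (?P L))
      = (\<Sum>L\<in>spanned_lines S. int (card L) * (int (card L) - 1))"
    unfolding of_nat_sum
    by (intro sum.cong refl c) (meson assms finite_subset spanned_lines_subset)
  ultimately show ?thesis using c[OF assms] by simp
qed

section \<open>Cuts obtained by rotating a spanned line\<close>

text \<open>Betweenness is encoded by inner products with the direction \<open>q - p\<close>: a
  collinear point of \<open>S\<close> is at or behind \<open>p\<close>, or at or beyond
  \<open>q\<close>.\<close>

definition adjacent :: "(real \<times> real) set \<Rightarrow> real \<times> real \<Rightarrow> real \<times> real \<Rightarrow> bool" where
  "adjacent S p q \<longleftrightarrow> p \<in> S \<and> q \<in> S \<and> p \<noteq> q \<and>
    (\<forall>r\<in>S. orient p q r = 0 \<longrightarrow> (q - p) \<bullet> (r - p) \<le> 0 \<or> (q - p) \<bullet> (r - q) \<ge> 0)"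

text \<open>The left side of the slightly rotated line: a counterclockwise turn about a pivot
  between \<open>p\<close> and \<open>q\<close> moves the points of the old line at or behind
  \<open>p\<close> to the left, and those from \<open>q\<close> onwards to the right.\<close>

definition cut_part :: "(real \<times> real) set \<Rightarrow> real \<times> real \<Rightarrow> real \<times> real \<Rightarrow> (real \<times> real) set" where
  "cut_part S p q = {r \<in> S. orient p q r > 0 \<or> orient p q r = 0 \<and> (q - p) \<bullet> (r - p) \<le> 0}"

lemma finite_attains_max:
  fixes f :: "'b \<Rightarrow> real"
  assumes "finite A" "A \<noteq> {}"
  shows "\<exists>m\<in>A. \<forall>x\<in>A. f x \<le> f m"
proof -
  have "Max (f ` A) \<in> f ` A" using assms by (intro Max_in) auto
  then obtain m where "m \<in> A" "f m = Max (f ` A)" by force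
  then show ?thesis using assms by (metis Max_ge finite_imageI imageI)
qed

lemma inner_shift: "(q - p) \<bullet> (r - p) = (q - p) \<bullet> (r - q) + (q - p) \<bullet> (q - p)" for p q r :: "real \<times> real"
  by (simp add: inner_diff_right algebra_simps)

lemma inner_reverse: "(p - q) \<bullet> x = - ((q - p) \<bullet> x)" for p q x :: "real \<times> real"
  by (simp add: inner_diff_left)

lemma adjacent_commute: "adjacent S p q \<Longrightarrow> adjacent S q p"
  unfolding adjacent_def by (auto simp: orient_swap[of q p] inner_reverse[of p q])

text \<open>Exchanging \<open>p\<close> and \<open>q\<close> reverses the direction of the rotated
  line. Adjacency excludes collinear points strictly between them, which would belong to neither
  part.\<close>

lemma cut_swap:
  assumes "adjacent S p q"
  shows "cut_part S q p = S - cut_part S p q"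
proof -
  have pos: "(q - p) \<bullet> (q - p) > 0" using assms unfolding adjacent_def inner_gt_zero_iff by auto
  have "r \<in> cut_part S q p \<longleftrightarrow> r \<notin> cut_part S p q" if "r \<in> S" for r
  proof (cases "orient p q r = 0")
    case True
    then have "(q - p) \<bullet> (r - p) \<le> 0 \<or> (q - p) \<bullet> (r - q) \<ge> 0"
      using assms that by (simp add: adjacent_def)
    then have "(q - p) \<bullet> (r - q) \<ge> 0 \<longleftrightarrow> \<not> (q - p) \<bullet> (r - p) \<le> 0"
      using pos inner_shift[of q p r] by linarith
    then show ?thesis using that True
      by (simp add: cut_part_def orient_swap[of q p] inner_reverse[of p q])
  next
    case False
    then show ?thesis using that by (auto simp: cut_part_def orient_swap[of q p])
  qed
  moreover have "cut_part S q p \<subseteq> S" by (auto simp: cut_part_def)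
  ultimately show ?thesis by blast
qed

lemma cut_mem:
  assumes "adjacent S p q"
  shows "p \<in> cut_part S p q" "q \<in> S - cut_part S p q"
  using assms by (auto simp: cut_part_def adjacent_def inner_eq_zero_iff dest: antisym)

text \<open>By the exchange identity, two lines weakly separating the same pair of sets, both touching
  each set and with the same handedness, coincide.\<close>

lemma cut_inj:
  assumes 1: "adjacent S p q" and 2: "adjacent S p' q'" and eq: "cut_part S p q = cut_part S p' q'"
  shows "p = p' \<and> q = q'"
proof -
  have m: "p \<in> cut_part S p' q'" "q \<in> S - cut_part S p' q'" "p' \<in> cut_part S p q" "q' \<in> S - cut_part S p q"
    using cut_mem[OF 1] cut_mem[OF 2] eq by auto
  have s: "orient p' q' p \<ge> 0" "orient p' q' q \<le> 0" "orient p q p' \<ge> 0" "orient p q q' \<le> 0"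
    using m by (auto simp: cut_part_def)
  then have z: "orient p' q' p = 0" "orient p' q' q = 0" "orient p q p' = 0" "orient p q q' = 0"
    using orient_exchange[of p' q' q p] by linarith+
  have ne: "p \<noteq> q" "p' \<noteq> q'" using 1 2 by (auto simp: adjacent_def)
  \<comment> \<open>All four points are now collinear, with \<open>p\<close> at parameter 0 and
    \<open>q\<close> at 1. Membership in the parts and adjacency of \<open>p\<close>,
    \<open>q\<close> give \<open>s \<le> 0\<close> and \<open>t \<ge> 1\<close>; the same argument
    for \<open>p'\<close>, \<open>q'\<close> gives the reverse inequalities.\<close>
  obtain s where s: "p' = p + s *\<^sub>R (q - p)" using on_line_parameter[OF ne(1) z(3)] .
  obtain t where t: "q' = p + t *\<^sub>R (q - p)" using on_line_parameter[OF ne(1) z(4)] .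
  define N where "N = (q - p) \<bullet> (q - p)"
  have N: "N > 0" using ne by (simp add: N_def)
  have d': "q' - p' = (t - s) *\<^sub>R (q - p)" by (simp add: s t algebra_simps)
  have "(q - p) \<bullet> (p' - p) \<le> 0" using m(3) z by (auto simp: cut_part_def)
  then have "s * N \<le> 0" by (simp add: s N_def)
  then have s0: "s \<le> 0" using N by (simp add: mult_le_0_iff)
  have "(q - p) \<bullet> (q' - p) > 0" using m(4) z by (auto simp: cut_part_def)
  then have "(q - p) \<bullet> (q' - q) \<ge> 0" using 1 z m(4) by (auto simp: adjacent_def)
  then have "(t - 1) * N \<ge> 0" using inner_shift[of q p q'] by (simp add: t N_def algebra_simps)
  then have t1: "t \<ge> 1" using N by (simp add: zero_le_mult_iff)
  have "(q' - p') \<bullet> (p - p') \<le> 0" using m(1) z by (auto simp: cut_part_def)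
  then have "(t - s) * ((- s) * N) \<le> 0" unfolding d' by (simp add: s N_def mult.left_commute)
  then have "s \<ge> 0" using N s0 t1 by (simp add: mult_le_0_iff zero_le_mult_iff)
  then have "s = 0" using s0 by simp
  have "(q' - p') \<bullet> (q - p') > 0" using m(2) z by (auto simp: cut_part_def)
  then have "(q' - p') \<bullet> (q - q') \<ge> 0" using 2 z m(2) by (auto simp: adjacent_def)
  moreover have "q - q' = (1 - t) *\<^sub>R (q - p)" by (simp add: t algebra_simps)
  ultimately have "(t - s) * ((1 - t) * N) \<ge> 0" unfolding d' by (simp add: N_def mult.left_commute)
  then have "t \<le> 1" using N s0 t1 by (simp add: zero_le_mult_iff)
  then show ?thesis using \<open>s = 0\<close> t1 s t by simp
qed

text \<open>Rotate the line through \<open>p\<close> and \<open>q\<close> counterclockwise about \<open>p\<close> until it meets a further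
  point \<open>r\<close>; the quotient being maximised is the cotangent of the rotation angle.\<close>

lemma rotate_to_next_point:
  assumes adj: "adjacent S p q" and fin: "finite S" and nc: "\<exists>z\<in>S. orient p q z \<noteq> 0"
  shows "\<exists>r\<in>S. r \<noteq> p \<and> (cut_part S p q = {x \<in> S. orient p r x \<ge> 0} \<or>
    (r \<notin> cut_part S p q \<and> orient p q r < 0 \<and> (\<forall>x\<in>cut_part S p q. orient p r x \<le> 0)
      \<and> (\<forall>x\<in>S - cut_part S p q. orient p r x \<ge> 0)))"
proof -
  define N where "N = (q - p) \<bullet> (q - p)"
  have N: "N > 0" using adj unfolding N_def adjacent_def inner_gt_zero_iff by auto
  define c where "c x = (q - p) \<bullet> (x - p) / orient p q x" for x
  define Z where "Z = {x \<in> S. orient p q x \<noteq> 0}"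
  have Z: "finite Z" "Z \<noteq> {}" using fin nc by (auto simp: Z_def)
  obtain r0 where r0: "r0 \<in> Z" "\<And>x. x \<in> Z \<Longrightarrow> c x \<le> c r0"
    using finite_attains_max[OF Z, of c] by blast
  \<comment> \<open>The side of the line \<open>p r\<close> on which \<open>x\<close> lies is thus
    read off from the sides of \<open>r\<close> and \<open>x\<close> with respect to
    \<open>p q\<close> and from the comparison of cotangents.\<close>
  have off: "N * orient p r x = orient p q r * orient p q x * (c r - c x)"
    if "r \<in> Z" "x \<in> Z" for r x
  proof -
    have "orient p q r * c r = (q - p) \<bullet> (r - p)" "orient p q x * c x = (q - p) \<bullet> (x - p)"
      using that by (simp_all add: c_def Z_def)
    then have "N * orient p r x = orient p q r * c r * orient p q x - orient p q r * (orient p q x * c x)"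
      using orient_triple_inner[of q p r x] by (simp only: N_def)
    then show ?thesis by (simp add: algebra_simps)
  qed
  have on: "N * orient p r x = - orient p q r * ((q - p) \<bullet> (x - p))" if "orient p q x = 0" for r x
    using that orient_triple_inner[of q p r x] by (simp add: N_def)
  have sgn: "orient p r x \<ge> 0 \<longleftrightarrow> N * orient p r x \<ge> 0" "orient p r x \<le> 0 \<longleftrightarrow> N * orient p r x \<le> 0" for r x
    using N by (simp_all add: zero_le_mult_iff mult_le_0_iff)
  show ?thesis
  \<comment> \<open>A point right of \<open>p q\<close> is hit by the backward ray, so if a
    maximiser lies there, \<open>p r\<close> has the reversed direction and separates the parts only
    weakly. Otherwise every point hit lies in the cut part, the right points have strictly smaller
    cotangent, and the part is exactly a closed side.\<close>
  proof (cases "\<exists>r\<in>Z. c r = c r0 \<and> orient p q r < 0")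
    case True
    then obtain r where r: "r \<in> Z" "orient p q r < 0" "\<And>x. x \<in> Z \<Longrightarrow> c x \<le> c r"
      using r0 by metis
    have "orient p r x \<le> 0" if "x \<in> cut_part S p q" for x
    proof (cases "orient p q x = 0")
      case True
      then have "(q - p) \<bullet> (x - p) \<le> 0" using that by (simp add: cut_part_def)
      then show ?thesis unfolding sgn on[OF True] using r(2) by (simp add: mult_le_0_iff zero_le_mult_iff)
    next
      case False
      then have x: "x \<in> Z" "orient p q x > 0" using that by (auto simp: cut_part_def Z_def)
      then show ?thesis unfolding sgn off[OF r(1) x(1)] using r
        by (simp add: mult_nonpos_nonneg)
    qed
    moreover have "orient p r x \<ge> 0" if "x \<in> S - cut_part S p q" for x
    proof (cases "orient p q x = 0")
      case True
      then have "(q - p) \<bullet> (x - p) \<ge> 0" using that by (auto simp: cut_part_def)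
      then show ?thesis unfolding sgn on[OF True] using r(2) by (simp add: mult_le_0_iff zero_le_mult_iff)
    next
      case False
      then have x: "x \<in> Z" "orient p q x < 0" using that by (auto simp: cut_part_def Z_def)
      then show ?thesis unfolding sgn off[OF r(1) x(1)] using r
        by (simp add: mult_nonpos_nonpos)
    qed
    moreover have "r \<notin> cut_part S p q" "r \<in> S" "r \<noteq> p" using r by (auto simp: cut_part_def Z_def)
    ultimately show ?thesis using r(2) by blast
  next
    case False
    have r: "orient p q r0 > 0"
      using False r0(1) by (fastforce simp: Z_def)
    have r2: "c x < c r0" if "x \<in> Z" "orient p q x < 0" for x
      using False r0(2)[OF that(1)] that by force
    have "orient p r0 x \<ge> 0" if "x \<in> cut_part S p q" for x
    proof (cases "orient p q x = 0")
      case True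
      then have "(q - p) \<bullet> (x - p) \<le> 0" using that by (simp add: cut_part_def)
      then show ?thesis unfolding sgn on[OF True] using r by (simp add: mult_le_0_iff)
    next
      case False
      then have x: "x \<in> Z" "orient p q x > 0" using that by (auto simp: cut_part_def Z_def)
      then show ?thesis unfolding sgn off[OF r0(1) x(1)] using r r0(2) by simp
    qed
    moreover have "\<not> orient p r0 x \<ge> 0" if "x \<in> S - cut_part S p q" for x
    proof (cases "orient p q x = 0")
      case True
      then have "(q - p) \<bullet> (x - p) > 0" using that by (auto simp: cut_part_def)
      then show ?thesis unfolding sgn on[OF True] using r by (simp add: mult_le_0_iff)
    next
      case False
      then have x: "x \<in> Z" "orient p q x < 0" using that by (auto simp: cut_part_def Z_def)
      then show ?thesis unfolding sgn off[OF r0(1) x(1)] using r r2[OF x]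
        by (simp add: zero_le_mult_iff)
    qed
    ultimately have "cut_part S p q = {x \<in> S. orient p r0 x \<ge> 0}" by (auto simp: cut_part_def)
    moreover have "r0 \<in> S" "r0 \<noteq> p" using r0 by (auto simp: Z_def)
    ultimately show ?thesis by blast
  qed
qed

text \<open>If rotating about \<open>p\<close> and rotating about \<open>q\<close> both stop at a point of the other part, the two
  stopping lines coincide by the exchange identity, hence contain \<open>p\<close> and \<open>q\<close>.\<close>

lemma cut_is_side:
  assumes adj: "adjacent S p q" and fin: "finite S" and nc: "\<exists>z\<in>S. orient p q z \<noteq> 0"
  shows "\<exists>a\<in>S. \<exists>b\<in>S. a \<noteq> b \<and>
    (cut_part S p q = {x \<in> S. orient a b x \<ge> 0} \<or> cut_part S p q = {x \<in> S. orient a b x > 0})"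
proof -
  have pq: "p \<in> S" "q \<in> S" using adj by (auto simp: adjacent_def)
  have adj': "adjacent S q p" by (rule adjacent_commute[OF adj])
  have sub: "cut_part S p q \<subseteq> S" by (auto simp: cut_part_def)
  note sw = cut_swap[OF adj]
  obtain r where r: "r \<in> S" and r'': "r \<noteq> p \<and> (cut_part S p q = {x \<in> S. orient p r x \<ge> 0} \<or>
    (r \<notin> cut_part S p q \<and> orient p q r < 0 \<and> (\<forall>x\<in>cut_part S p q. orient p r x \<le> 0)
      \<and> (\<forall>x\<in>S - cut_part S p q. orient p r x \<ge> 0)))"
    using rotate_to_next_point[OF adj fin nc] by (rule bexE)
  have nc': "\<exists>z\<in>S. orient q p z \<noteq> 0" using nc by (simp add: orient_swap[of q p])
  obtain s where s: "s \<in> S" and s'': "s \<noteq> q \<and> (cut_part S q p = {x \<in> S. orient q s x \<ge> 0} \<or>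
    (s \<notin> cut_part S q p \<and> orient q p s < 0 \<and> (\<forall>x\<in>cut_part S q p. orient q s x \<le> 0)
      \<and> (\<forall>x\<in>S - cut_part S q p. orient q s x \<ge> 0)))"
    using rotate_to_next_point[OF adj' fin nc'] by (rule bexE)
  from conjunct2[OF r''] show ?thesis
  proof
    assume "cut_part S p q = {x \<in> S. orient p r x \<ge> 0}"
    then show ?thesis using r conjunct1[OF r''] pq(1) by metis
  next
    assume R: "r \<notin> cut_part S p q \<and> orient p q r < 0 \<and> (\<forall>x\<in>cut_part S p q. orient p r x \<le> 0)
      \<and> (\<forall>x\<in>S - cut_part S p q. orient p r x \<ge> 0)"
    from conjunct2[OF s''] show ?thesis
    proof
      assume "cut_part S q p = {x \<in> S. orient q s x \<ge> 0}"
      \<comment> \<open>The complement of a closed side is the open side of the reversed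
        line.\<close>
      then have "cut_part S p q = S - {x \<in> S. orient q s x \<ge> 0}" using sw sub by auto
      also have "\<dots> = {x \<in> S. orient s q x > 0}" by (auto simp: orient_swap[of s q])
      finally show ?thesis using s conjunct1[OF s''] pq(2) by metis
    next
      assume T: "s \<notin> cut_part S q p \<and> orient q p s < 0 \<and> (\<forall>x\<in>cut_part S q p. orient q s x \<le> 0)
        \<and> (\<forall>x\<in>S - cut_part S q p. orient q s x \<ge> 0)"
      have mem: "r \<in> cut_part S q p" "p \<in> S - cut_part S q p" "s \<in> cut_part S p q" "q \<in> S - cut_part S p q"
        using conjunct1[OF T] conjunct1[OF R] sw r s cut_mem[OF adj] cut_mem[OF adj'] by blast+
      have "orient q s r \<le> 0" "orient q s p \<ge> 0"
        using T mem by auto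
      moreover have "orient p r s \<le> 0" "orient p r q \<ge> 0"
        using R mem by auto
      \<comment> \<open>The exchange identity for \<open>s q\<close> and \<open>p r\<close> is a
        vanishing sum of four nonnegative terms.\<close>
      ultimately have "orient p r q = 0"
        using orient_exchange[of s q r p] orient_swap[of s q r] orient_swap[of s q p] by linarith
      then have "orient p q r = 0"
        by (simp add: orient_flip[of p r q])
      then show ?thesis using R by simp
    qed
  qed
qed

section \<open>Melchior's inequality\<close>

definition sides :: "(real \<times> real) set \<Rightarrow> (real \<times> real) set \<Rightarrow> (real \<times> real) set set" where
  "sides S L = {A. \<exists>a\<in>L. \<exists>b\<in>L. a \<noteq> b \<and>
    (A = {x \<in> S. orient a b x \<ge> 0} \<or> A = {x \<in> S. orient a b x > 0})}"

text \<open>Two points of \<open>L\<close> determine \<open>orient\<close> up to a nonzero factor,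
  whose sign only exchanges left and right; hence at most two closed and two open sides
  occur.\<close>

lemma card_sides:
  assumes "L \<in> spanned_lines S"
  shows "finite (sides S L)" "card (sides S L) \<le> 4"
proof -
  obtain a b where ab: "a \<noteq> b" "L = spanned_line S a b"
    using assms by (auto simp: spanned_lines_def)
  let ?T = "{{x \<in> S. orient a b x \<ge> 0}, {x \<in> S. orient a b x > 0},
      {x \<in> S. orient a b x \<le> 0}, {x \<in> S. orient a b x < 0}}"
  have sub: "sides S L \<subseteq> ?T"
  proof
    fix A assume "A \<in> sides S L"
    then obtain c d where cd: "c \<in> L" "d \<in> L" "c \<noteq> d"
      and A: "A = {x \<in> S. orient c d x \<ge> 0} \<or> A = {x \<in> S. orient c d x > 0}"
      by (auto simp: sides_def)
    obtain l where l: "l \<noteq> 0" "\<And>x. orient c d x = l * orient a b x"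
      using orient_proportional[OF ab(1) cd(3)] cd ab(2) by (auto simp: spanned_line_def)
    show "A \<in> ?T"
    proof (cases "l > 0")
      case True
      then show ?thesis using A by (auto simp: l zero_le_mult_iff zero_less_mult_iff)
    next
      case False
      then have "l < 0" using l by simp
      then show ?thesis using A by (auto simp: l zero_le_mult_iff zero_less_mult_iff)
    qed
  qed
  show "finite (sides S L)" by (rule finite_subset[OF sub]) simp
  have "card (sides S L) \<le> card ?T" by (rule card_mono[OF _ sub]) simp
  also have "\<dots> \<le> 4" by (auto simp: card_insert_if)
  finally show "card (sides S L) \<le> 4" .
qed

text \<open>Every element except the one of largest value has a successor.\<close>

lemma card_consecutive_pairs:
  fixes f :: "'b \<Rightarrow> real"
  assumes "finite L" "inj_on f L"
  shows "card L - 1 \<le> card {(p, q). p \<in> L \<and> q \<in> L \<and> f p < f q \<and> (\<forall>r\<in>L. f r \<le> f p \<or> f q \<le> f r)}"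
    (is "_ \<le> card ?C")
proof (cases "L = {}")
  case False
  have finC: "finite ?C" by (rule finite_subset[of _ "L \<times> L"]) (use assms in auto)
  obtain m where m: "m \<in> L" "\<And>x. x \<in> L \<Longrightarrow> f x \<le> f m"
    using finite_attains_max[OF assms(1) False, of f] by blast
  have "L - {m} \<subseteq> fst ` ?C"
  proof
    fix p assume p: "p \<in> L - {m}"
    then have "f p < f m" using m(1) m(2)[of p] inj_onD[OF assms(2), of p m] by force
    let ?U = "{q \<in> L. f p < f q}"
    have U: "finite (f ` ?U)" "f ` ?U \<noteq> {}" using assms m \<open>f p < f m\<close> by auto
    obtain q where q: "q \<in> ?U" "f q = Min (f ` ?U)" using Min_in[OF U] by auto
    have "f q \<le> f r" if "r \<in> L" "f p < f r" for r
      unfolding q(2) by (rule Min_le[OF U(1)]) (use that in auto)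
    then have "(p, q) \<in> ?C" using p q by force
    then show "p \<in> fst ` ?C" by force
  qed
  then have "card (L - {m}) \<le> card ?C" using finC surj_card_le by blast
  then show ?thesis using m by simp
qed simp

text \<open>Order the points of \<open>L\<close> by their projection on its direction. Consecutive
  points are adjacent in either order, and the increasing and decreasing pairs are disjoint, whence
  the factor 2.\<close>

lemma card_adjacent_on_line:
  assumes fin: "finite S" and L: "L \<in> spanned_lines S"
  shows "2 * (card L - 1) \<le> card {(p, q). p \<in> L \<and> q \<in> L \<and> adjacent S p q}" (is "_ \<le> card ?P")
proof -
  obtain a b where ab: "a \<noteq> b" "L = spanned_line S a b"
    using L by (auto simp: spanned_lines_def)
  have finL: "finite L" and LS: "L \<subseteq> S" using L fin spanned_lines_subset finite_subset by metis+
  define f where "f r = (b - a) \<bullet> (r - a)" for r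
  define N where "N = (b - a) \<bullet> (b - a)"
  have N: "N > 0" using ab by (simp add: N_def)
  have par: "\<exists>t. r = a + t *\<^sub>R (b - a) \<and> f r = t * N" if r: "r \<in> L" for r
  proof -
    obtain t where "r = a + t *\<^sub>R (b - a)"
      using on_line_parameter[OF ab(1), of r] r ab(2) unfolding spanned_line_def by blast
    then show ?thesis by (auto simp: f_def N_def)
  qed
  have inj: "inj_on f L"
  proof (rule inj_onI)
    fix x y assume "x \<in> L" "y \<in> L" and eq: "f x = f y"
    then obtain t u where "x = a + t *\<^sub>R (b - a)" "f x = t * N" "y = a + u *\<^sub>R (b - a)" "f y = u * N"
      using par by meson
    then show "x = y" using eq N by simp
  qed
  let ?C = "{(p, q). p \<in> L \<and> q \<in> L \<and> f p < f q \<and> (\<forall>r\<in>L. f r \<le> f p \<or> f q \<le> f r)}"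
  have finC: "finite ?C" by (rule finite_subset[of _ "L \<times> L"]) (use finL in auto)
  have finP: "finite ?P" by (rule finite_subset[of _ "L \<times> L"]) (use finL in auto)
  have adj: "adjacent S p q" if C: "(p, q) \<in> ?C" for p q
    unfolding adjacent_def
  proof (intro conjI ballI impI)
    show "p \<in> S" "q \<in> S" "p \<noteq> q" using C LS by auto
    fix r assume "r \<in> S" "orient p q r = 0"
    then have "r \<in> spanned_line S p q" by (simp add: spanned_line_def)
    then have r: "r \<in> L" using spanned_lines_eq[OF L, of p q] C by auto
    obtain t where t: "p = a + t *\<^sub>R (b - a)" "f p = t * N" using par C by blast
    obtain u where u: "q = a + u *\<^sub>R (b - a)" "f q = u * N" using par C by blast
    obtain w where w: "r = a + w *\<^sub>R (b - a)" "f r = w * N" using par r by blast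
    have "t < u" using C t u N by simp
    have "w \<le> t \<or> u \<le> w" using C r t u w N by auto
    moreover have "q - p = (u - t) *\<^sub>R (b - a)" "r - p = (w - t) *\<^sub>R (b - a)" "r - q = (w - u) *\<^sub>R (b - a)"
      by (simp_all add: t u w algebra_simps)
    then have "(q - p) \<bullet> (r - p) = (u - t) * ((w - t) * N)" "(q - p) \<bullet> (r - q) = (u - t) * ((w - u) * N)"
      by (simp_all add: N_def)
    ultimately show "(q - p) \<bullet> (r - p) \<le> 0 \<or> (q - p) \<bullet> (r - q) \<ge> 0"
      using \<open>t < u\<close> N by (auto simp: mult_le_0_iff zero_le_mult_iff)
  qed
  have sub: "?C \<union> prod.swap ` ?C \<subseteq> ?P"
  proof (rule Un_least)
    show C: "?C \<subseteq> ?P" using adj by blast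
    show "prod.swap ` ?C \<subseteq> ?P"
    proof
      fix z assume "z \<in> prod.swap ` ?C"
      then obtain p q where "z = (q, p)" "(p, q) \<in> ?C" by force
      then show "z \<in> ?P" using adj[of p q] adjacent_commute by blast
    qed
  qed
  have "?C \<inter> prod.swap ` ?C = {}" by auto
  then have "card (?C \<union> prod.swap ` ?C) = card ?C + card (prod.swap ` ?C)"
    using finC by (intro card_Un_disjoint) auto
  also have "card (prod.swap ` ?C) = card ?C"
    by (rule card_image) (simp add: inj_on_def)
  finally have "2 * card ?C \<le> card ?P"
    using card_mono[OF finP sub] by simp
  then show ?thesis using card_consecutive_pairs[OF finL inj] by linarith
qed

text \<open>One step of gift wrapping: \<open>p\<close> is the lowest of the leftmost points, and
  \<open>r\<close> minimises the slope seen from \<open>p\<close>. If all abscissas agree,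
  \<open>S\<close> is collinear and any two of its points serve.\<close>

lemma supporting_line:
  assumes fin: "finite S" and ne: "a0 \<in> S" "b0 \<in> S" "a0 \<noteq> b0"
  shows "\<exists>a\<in>S. \<exists>b\<in>S. a \<noteq> b \<and> (\<forall>x\<in>S. orient a b x \<ge> 0)"
proof -
  define m where "m = Min (fst ` S)"
  have m: "\<And>x. x \<in> S \<Longrightarrow> m \<le> fst x" "m \<in> fst ` S"
    unfolding m_def using fin ne by (auto intro!: Min_in)
  let ?V = "{x \<in> S. fst x = m}"
  have V: "finite (snd ` ?V)" "snd ` ?V \<noteq> {}" using fin m by auto
  obtain p where p: "p \<in> ?V" "snd p = Min (snd ` ?V)" using Min_in[OF V] by auto
  have p': "snd p \<le> snd x" if "x \<in> S" "fst x = m" for x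
    unfolding p(2) by (rule Min_le[OF V(1)]) (use that in auto)
  have pS: "p \<in> S" "fst p = m" using p by auto
  show ?thesis
  proof (cases "\<exists>x\<in>S. fst x > m")
    case False
    then have "fst x = m" if "x \<in> S" for x using m(1)[OF that] that False by force
    then have "orient a0 b0 x \<ge> 0" if "x \<in> S" for x
      using that ne by (simp add: orient_def)
    then show ?thesis using ne by blast
  next
    case True
    define g where "g x = (snd x - snd p) / (fst x - m)" for x
    let ?U = "{x \<in> S. fst x > m}"
    have U: "finite (g ` ?U)" "g ` ?U \<noteq> {}" using fin True by auto
    obtain r where r: "r \<in> ?U" "g r = Min (g ` ?U)" using Min_in[OF U] by auto
    have "orient p r x \<ge> 0" if x: "x \<in> S" for x
    proof (cases "fst x = m")
      case True
      then show ?thesis using p'[OF x] pS r by (simp add: orient_def)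
    next
      case False
      then have xm: "fst x > m" using m(1)[OF x] by simp
      then have "g r \<le> g x" unfolding r(2) by (intro Min_le[OF U(1)]) (use x in auto)
      then show ?thesis using r xm by (simp add: g_def orient_def pS field_simps)
    qed
    moreover have "p \<noteq> r" "r \<in> S" using pS r by auto
    ultimately show ?thesis using pS by blast
  qed
qed

lemma weak_melchior:
  assumes fin: "finite S" and nc: "\<And>L. L \<in> spanned_lines S \<Longrightarrow> L \<noteq> S"
    and ne: "a0 \<in> S" "b0 \<in> S" "a0 \<noteq> b0"
  shows "(\<Sum>L\<in>spanned_lines S. 3 - int (card L)) > 0"
proof -
  let ?LL = "spanned_lines S"
  define Adj where "Adj = {(p, q). adjacent S p q}"
  let ?P = "\<lambda>L. {(p, q). p \<in> L \<and> q \<in> L \<and> adjacent S p q}"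
  have finA: "finite Adj"
    by (rule finite_subset[of _ "S \<times> S"]) (use fin in \<open>auto simp: Adj_def adjacent_def\<close>)
  have "(\<Sum>L\<in>?LL. 2 * (card L - 1)) \<le> (\<Sum>L\<in>?LL. card (?P L))"
    by (intro sum_mono card_adjacent_on_line fin)
  also have "\<dots> = card (\<Union>L\<in>?LL. ?P L)"
    by (rule sum_card_pairs_on_lines[OF fin]) (auto simp: adjacent_def)
  also have "\<dots> \<le> card Adj"
    by (rule card_mono[OF finA]) (auto simp: Adj_def)
  also have "\<dots> = card ((\<lambda>(p, q). cut_part S p q) ` Adj)"
    by (rule card_image[symmetric]) (auto simp: inj_on_def Adj_def dest!: cut_inj[rotated 2])
  finally have 1: "(\<Sum>L\<in>?LL. 2 * (card L - 1)) \<le> card ((\<lambda>(p, q). cut_part S p q) ` Adj)" (is "_ \<le> card ?I") .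
  let ?T = "\<Union>L\<in>?LL. sides S L"
  have side: "{x \<in> S. orient a b x \<ge> 0} \<in> ?T" "{x \<in> S. orient a b x > 0} \<in> ?T"
    if "a \<in> S" "b \<in> S" "a \<noteq> b" for a b
  proof -
    have "a \<in> spanned_line S a b" "b \<in> spanned_line S a b" using that by (auto simp: spanned_line_def)
    then show "{x \<in> S. orient a b x \<ge> 0} \<in> ?T" "{x \<in> S. orient a b x > 0} \<in> ?T"
      unfolding UN_iff sides_def using spanned_line_in_lines[OF that] that(3) by blast+
  qed
  obtain a b where ab: "a \<in> S" "b \<in> S" "a \<noteq> b" "\<forall>x\<in>S. orient a b x \<ge> 0"
    using supporting_line[OF fin ne] by blast
  have "{x \<in> S. orient a b x \<ge> 0} = S" using ab by auto
  then have "S \<in> ?T" using side(1)[OF ab(1-3)] by simp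
  moreover have "{x \<in> S. orient b a x > 0} = {}" using ab by (auto simp: orient_swap[of b a])
  then have "{} \<in> ?T" using side(2)[of b a] ab(1-3) by metis
  moreover have "?I \<subseteq> ?T"
  proof
    fix A assume "A \<in> ?I"
    then obtain p q where pq: "adjacent S p q" "A = cut_part S p q" by (auto simp: Adj_def)
    then have pq': "p \<in> S" "q \<in> S" "p \<noteq> q" by (auto simp: adjacent_def)
    \<comment> \<open>Noncollinearity guarantees that the rotation meets a further point.\<close>
    have "spanned_line S p q \<noteq> S" using nc spanned_line_in_lines[OF pq'] by blast
    then have "\<exists>z\<in>S. orient p q z \<noteq> 0" by (auto simp: spanned_line_def)
    then obtain c d where cd: "c \<in> S" "d \<in> S" "c \<noteq> d"
      and "cut_part S p q = {x \<in> S. orient c d x \<ge> 0} \<or> cut_part S p q = {x \<in> S. orient c d x > 0}"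
      using cut_is_side[OF pq(1) fin] by meson
    then show "A \<in> ?T" unfolding pq(2) using side[OF cd] by (elim disjE) simp_all
  qed
  ultimately have sub: "insert S (insert {} ?I) \<subseteq> ?T" by auto
  have proper: "A \<noteq> S \<and> A \<noteq> {}" if A: "A \<in> ?I" for A
  proof -
    obtain p q where "adjacent S p q" "A = cut_part S p q" using A unfolding Adj_def by blast
    then show ?thesis using cut_mem[of S p q] by blast
  qed
  \<comment> \<open>These two additional sides supply the 2 that makes the final inequality
    strict.\<close>
  have "S \<notin> ?I" "{} \<notin> ?I" using proper[of S] proper[of "{}"] by metis+
  moreover have "S \<noteq> {}" using ne by blast
  ultimately have "card ?I + 2 = card (insert S (insert {} ?I))" using finA by simp
  also have "\<dots> \<le> card ?T"
    using finite_spanned_lines[OF fin] card_sides(1) by (intro card_mono[OF _ sub]) blast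
  also have "\<dots> \<le> (\<Sum>L\<in>?LL. card (sides S L))"
    by (rule card_UN_le[OF finite_spanned_lines[OF fin]])
  also have "\<dots> \<le> (\<Sum>L\<in>?LL. 4)" by (intro sum_mono card_sides(2))
  finally have "(\<Sum>L\<in>?LL. 2 * (card L - 1)) + 2 \<le> (\<Sum>L\<in>?LL. 4::nat)" using 1 by linarith
  then have "int (\<Sum>L\<in>?LL. 2 * (card L - 1)) + 2 \<le> int (\<Sum>L\<in>?LL. 4)" by linarith
  \<comment> \<open>The truncated subtraction is exact, since a spanned line has at least two
    points.\<close>
  moreover have "int (\<Sum>L\<in>?LL. 2 * (card L - 1)) = (\<Sum>L\<in>?LL. 2 * (int (card L) - 1))"
    unfolding of_nat_sum using spanned_lines_card[OF fin] by (intro sum.cong) (force simp: of_nat_diff)+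
  ultimately have "0 < (\<Sum>L\<in>?LL. 4 - 2 * (int (card L) - 1))"
    by (simp add: sum_subtractf)
  also have "\<dots> = 2 * (\<Sum>L\<in>?LL. 3 - int (card L))"
    unfolding sum_distrib_left by (intro sum.cong) auto
  finally show ?thesis by simp
qed

lemma many_rich_lines_bound:
  assumes fin: "finite S" and nc: "\<And>L. L \<in> spanned_lines S \<Longrightarrow> L \<noteq> S"
    and ne: "a0 \<in> S" "b0 \<in> S" "a0 \<noteq> b0"
    and K: "K \<subseteq> spanned_lines S" "\<And>L. L \<in> K \<Longrightarrow> card L = k" "card K = card S"
  shows "int (card S) > int k ^ 2 + int k - 5"
proof -
  let ?LL = "spanned_lines S"
  let ?n = "int (card S)"
  \<comment> \<open>This equals \<open>(j - 2) * (j + 3)\<close>; 2 is the largest multiplier of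
    \<open>3 - j\<close> that keeps the weight nonnegative at \<open>j = 2\<close>.\<close>
  let ?h = "\<lambda>j::int. j * (j - 1) - 2 * (3 - j)"
  have npos: "?n > 0" using fin ne by (auto simp: card_gt_0_iff)
  have "?n * ?h (int k) = (\<Sum>L\<in>K. ?h (int (card L)))"
    using K by simp
  also have "\<dots> \<le> (\<Sum>L\<in>?LL. ?h (int (card L)))"
  proof (rule sum_mono2[OF finite_spanned_lines[OF fin] K(1)])
    fix L assume "L \<in> ?LL - K"
    then have "int (card L) \<ge> 2" using spanned_lines_card[OF fin] by force
    then have "(int (card L) - 2) * (int (card L) + 3) \<ge> 0" by simp
    then show "0 \<le> ?h (int (card L))" by (simp add: algebra_simps)
  qed
  also have "\<dots> = (\<Sum>L\<in>?LL. int (card L) * (int (card L) - 1)) - 2 * (\<Sum>L\<in>?LL. 3 - int (card L))"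
    by (simp add: sum_subtractf sum_distrib_left)
  also have "\<dots> < ?n * (?n - 1)"
    using sum_ordered_pairs_le[OF fin] weak_melchior[OF fin nc ne] by linarith
  finally have "?h (int k) < ?n - 1" using npos by simp
  then show ?thesis by (simp add: power2_eq_square algebra_simps)
qed

section \<open>Coordinates for a realization\<close>

text \<open>Outside finitely many parameters, no given vector is orthogonal to a point of the moment
  curve \<open>(1, s, s\<^sup>2)\<close>; this provides an affine chart containing all points of a realization.\<close>

lemma exists_affine_chart:
  fixes v :: "'b \<Rightarrow> real ^ 3"
  assumes "finite E" "\<And>e. e \<in> E \<Longrightarrow> v e \<noteq> 0"
  shows "\<exists>s. \<forall>e\<in>E. v e $ 1 + s * v e $ 2 + s\<^sup>2 * v e $ 3 \<noteq> 0"
proof -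
  have fin: "finite {s. v e $ 1 + s * v e $ 2 + s\<^sup>2 * v e $ 3 = 0}" if e: "e \<in> E" for e
  proof -
    let ?p = "[:v e $ 1, v e $ 2, v e $ 3:]"
    have "?p \<noteq> 0" using assms(2)[OF e] by (auto simp: vec_eq_iff forall_3)
    then have "finite {s. poly ?p s = 0}" by (rule poly_roots_finite)
    then show ?thesis by (simp add: algebra_simps power2_eq_square)
  qed
  then have "finite (\<Union>e\<in>E. {s. v e $ 1 + s * v e $ 2 + s\<^sup>2 * v e $ 3 = 0})"
    using assms(1) by blast
  then obtain s where "s \<notin> (\<Union>e\<in>E. {s. v e $ 1 + s * v e $ 2 + s\<^sup>2 * v e $ 3 = 0})"
    using ex_new_if_finite[OF infinite_UNIV_char_0] by blast
  then show ?thesis by blast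
qed

text \<open>The projective points all avoid the line with normal vector (1, s, s^2). Taking it as
  the line at infinity, representatives are scaled into one affine plane.\<close>

lemma exists_normalized_vectors:
  assumes fin: "finite E" and p: "p ` E \<subseteq> proj_points"
  shows "\<exists>s v. \<forall>e\<in>E. p e = span {v e} \<and> v e $ 1 + s * v e $ 2 + s\<^sup>2 * v e $ 3 = 1"
proof -
  have "\<exists>w. w \<noteq> 0 \<and> p e = span {w}" if "e \<in> E" for e
  proof -
    have e: "subspace (p e)" "dim (p e) = 1" using p that by (auto simp: proj_points_def)
    have "\<not> p e \<subseteq> {0}" using e(2) by (simp flip: dim_eq_0)
    then obtain w where w: "w \<in> p e" "w \<noteq> 0" by blast
    have "dim {w} = 1" using w(2) by simp
    then have "span {w} = span (p e)"
      using e w(1) by (intro dim_eq_span) auto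
    then have "span {w} = p e" using e(1) span_eq_iff by metis
    then show ?thesis using w by blast
  qed
  then obtain w where w: "\<And>e. e \<in> E \<Longrightarrow> w e \<noteq> 0" "\<And>e. e \<in> E \<Longrightarrow> p e = span {w e}"
    by metis
  obtain s where s: "\<And>e. e \<in> E \<Longrightarrow> w e $ 1 + s * w e $ 2 + s\<^sup>2 * w e $ 3 \<noteq> 0"
    using exists_affine_chart[OF fin, of w] w(1) by blast
  define c where "c e = w e $ 1 + s * w e $ 2 + s\<^sup>2 * w e $ 3" for e
  define v where "v e = (1 / c e) *\<^sub>R w e" for e
  have "p e = span {v e} \<and> v e $ 1 + s * v e $ 2 + s\<^sup>2 * v e $ 3 = 1" if e: "e \<in> E" for e
  proof
    have c0: "c e \<noteq> 0" using s[OF e] by (simp add: c_def)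
    have "span {v e} = span {w e}"
      using span_image_scale[of "{w e}" "\<lambda>_. 1 / c e"] c0 by (simp add: v_def)
    then show "p e = span {v e}" using w(2)[OF e] by simp
    have "v e $ 1 + s * v e $ 2 + s\<^sup>2 * v e $ 3 = (w e $ 1 + s * w e $ 2 + s\<^sup>2 * w e $ 3) / c e"
      by (simp add: v_def add_divide_distrib)
    then show "v e $ 1 + s * v e $ 2 + s\<^sup>2 * v e $ 3 = 1" using c0 by (simp add: c_def)
  qed
  then show ?thesis by blast
qed

text \<open>The triple product is the determinant with rows \<open>a\<close>, \<open>b\<close>,
  \<open>r\<close>. Adding \<open>s\<close> times the second and s^2 times the third column to the
  first makes the first column all ones, leaving a planar signed area.\<close>

lemma cross3_inner_eq_orient:
  assumes "a $ 1 + s * a $ 2 + s\<^sup>2 * a $ 3 = 1" "b $ 1 + s * b $ 2 + s\<^sup>2 * b $ 3 = 1"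
    "r $ 1 + s * r $ 2 + s\<^sup>2 * r $ 3 = 1"
  shows "cross3 a b \<bullet> r = orient (a $ 2, a $ 3) (b $ 2, b $ 3) (r $ 2, r $ 3)"
proof -
  have *: "a $ 1 = 1 - s * a $ 2 - s\<^sup>2 * a $ 3" "b $ 1 = 1 - s * b $ 2 - s\<^sup>2 * b $ 3"
    "r $ 1 = 1 - s * r $ 2 - s\<^sup>2 * r $ 3" using assms by simp_all
  show ?thesis
    by (simp add: cross3_def inner_vec_def sum_3 orient_def *) (simp add: algebra_simps)
qed

text \<open>The cross product is a normal of the plane spanned by \<open>v a\<close> and
  \<open>v b\<close>, the only candidate for a common projective line.\<close>

lemma proj_collinear_iff_cross3:
  assumes ab: "a \<in> T" "b \<in> T" "cross3 (v a) (v b) \<noteq> 0"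
  shows "proj_collinear ((\<lambda>e. span {v e}) ` T) \<longleftrightarrow> (\<forall>r\<in>T. cross3 (v a) (v b) \<bullet> v r = 0)"
proof
  assume "proj_collinear ((\<lambda>e. span {v e}) ` T)"
  then obtain W where W: "subspace W" "dim W = 2" "\<And>e. e \<in> T \<Longrightarrow> v e \<in> W"
    unfolding proj_collinear_def proj_lines_def by (auto intro: span_base)
  obtain z where z: "z \<noteq> 0" "span W \<subseteq> {x. z \<bullet> x = 0}"
    using lowdim_subset_hyperplane[of W] W(2) by auto
  have z0: "z \<bullet> v e = 0" if "e \<in> T" for e using z(2) W(3)[OF that] span_base by auto
  \<comment> \<open>Expanding the double cross product leaves a combination of \<open>v a\<close>
    and \<open>v b\<close> with coefficients \<open>z \<bullet> v b\<close> and
    \<open>- (z \<bullet> v a)\<close>, both zero; so the two normals are parallel.\<close>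
  have "cross3 z (cross3 (v a) (v b)) = 0"
    using Lagrange[of z "v a" "v b"] z0 ab by simp
  then have "collinear {0, z, cross3 (v a) (v b)}" by (simp add: cross_eq_0)
  then obtain c where "cross3 (v a) (v b) = c *\<^sub>R z"
    using z(1) by (auto simp: collinear_lemma)
  then show "\<forall>r\<in>T. cross3 (v a) (v b) \<bullet> v r = 0" using z0 by simp
next
  assume r: "\<forall>r\<in>T. cross3 (v a) (v b) \<bullet> v r = 0"
  let ?W = "{x. cross3 (v a) (v b) \<bullet> x = 0}"
  have "?W \<in> proj_lines"
    using ab(3) by (simp add: proj_lines_def subspace_hyperplane dim_hyperplane)
  moreover have "span {v e} \<subseteq> ?W" if "e \<in> T" for e
    using r that by (intro span_minimal) (auto simp: subspace_hyperplane)
  ultimately show "proj_collinear ((\<lambda>e. span {v e}) ` T)" unfolding proj_collinear_def by blast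
qed

text \<open>In the affine chart the last two coordinates determine the first, so they serve as
  planar coordinates.\<close>

lemma (in matroid) realizable_plane_coordinates:
  assumes "realizable"
  shows "\<exists>\<phi>. inj_on \<phi> E \<and> (\<forall>T\<subseteq>E. \<forall>a\<in>T. \<forall>b\<in>T. a \<noteq> b \<longrightarrow>
    (rank T \<le> 2 \<longleftrightarrow> (\<forall>r\<in>T. orient (\<phi> a) (\<phi> b) (\<phi> r) = 0)))"
proof -
  obtain p where p: "inj_on p E" "p ` E \<subseteq> proj_points"
    and col: "\<And>T. T \<subseteq> E \<Longrightarrow> proj_collinear (p ` T) \<longleftrightarrow> rank T \<le> 2"
    using assms unfolding realizable_def by blast
  obtain s v where v: "\<And>e. e \<in> E \<Longrightarrow> p e = span {v e}"
    and w: "\<And>e. e \<in> E \<Longrightarrow> v e $ 1 + s * v e $ 2 + s\<^sup>2 * v e $ 3 = 1"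
    using exists_normalized_vectors[OF finite_ground p(2)] by blast
  define \<phi> where "\<phi> e = (v e $ 2, v e $ 3)" for e
  have inj: "inj_on \<phi> E"
  proof (rule inj_onI)
    fix x y assume xy: "x \<in> E" "y \<in> E" "\<phi> x = \<phi> y"
    then have "v x = v y" using w[OF xy(1)] w[OF xy(2)] by (simp add: \<phi>_def vec_eq_iff forall_3)
    then show "x = y" using v xy p(1) by (metis inj_onD)
  qed
  have nz: "cross3 (v a) (v b) \<noteq> 0" if "a \<in> E" "b \<in> E" "a \<noteq> b" for a b
  proof
    assume "cross3 (v a) (v b) = 0"
    moreover have "v a \<noteq> 0" "v b \<noteq> 0" using w that by force+
    ultimately obtain c where c: "v b = c *\<^sub>R v a" by (auto simp: cross_eq_0 collinear_lemma)
    have "c * (v a $ 1 + s * v a $ 2 + s\<^sup>2 * v a $ 3) = 1"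
      using w[OF that(2)] by (simp add: c algebra_simps)
    then have "v b = v a" using w[OF that(1)] c by simp
    then show False using v that p(1) by (metis inj_onD)
  qed
  have "rank T \<le> 2 \<longleftrightarrow> (\<forall>r\<in>T. orient (\<phi> a) (\<phi> b) (\<phi> r) = 0)"
    if "T \<subseteq> E" "a \<in> T" "b \<in> T" "a \<noteq> b" for T a b
  proof -
    have "p ` T = (\<lambda>e. span {v e}) ` T" using v that(1) by (intro image_cong) auto
    moreover have "cross3 (v a) (v b) \<bullet> v r = orient (\<phi> a) (\<phi> b) (\<phi> r)" if "r \<in> T" for r
      unfolding \<phi>_def using w that \<open>T \<subseteq> E\<close> \<open>a \<in> T\<close> \<open>b \<in> T\<close>
      by (intro cross3_inner_eq_orient[of _ s]) auto
    ultimately show ?thesis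
      using col[OF that(1)] proj_collinear_iff_cross3[of a T b v] nz[of a b] that by (simp add: subset_iff)
  qed
  then show ?thesis using inj by blast
qed

section \<open>Configurations\<close>

context nk_configuration
begin

lemma finite_lines: "finite {L. line L}"
  by (rule finite_subset[of _ "Pow E"]) (use finite_ground in \<open>auto simp: line_def flat_def\<close>)

text \<open>Double counting incidences between points and full lines gives \<open>n * k\<close> on
  one side and \<open>k\<close> times the number of full lines on the other.\<close>

lemma card_full_lines_total:
  assumes "0 < k"
  shows "card {L. line L \<and> card L = k} = n"
proof -
  let ?K = "{L. line L \<and> card L = k}"
  have finK: "finite ?K" by (rule finite_subset[OF _ finite_lines]) auto
  have "(\<Sum>x\<in>E. card {L \<in> ?K. x \<in> L}) = (\<Sum>L\<in>?K. card {x \<in> E. x \<in> L})"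
    using sum.swap_restrict[OF finite_ground finK, of "\<lambda>_ _. 1::nat" "\<lambda>x L. x \<in> L"] by simp
  moreover have "card {L \<in> ?K. x \<in> L} = k" if "x \<in> E" for x
    using card_full_lines[OF that] by (simp add: conj_ac)
  moreover have "{x \<in> E. x \<in> L} = L" if "L \<in> ?K" for L
    using that by (auto simp: line_def flat_def)
  ultimately have "n * k = card ?K * k" using card_ground by simp
  then show ?thesis using assms by simp
qed

lemma rank_attained:
  assumes "X \<subseteq> E"
  shows "\<exists>I\<subseteq>X. indep I \<and> card I = rank X"
proof -
  have fin: "finite {I. I \<subseteq> X \<and> indep I}"
    by (rule finite_subset[of _ "Pow E"]) (use finite_ground assms in auto)
  have "rank X \<in> card ` {I. I \<subseteq> X \<and> indep I}"
    unfolding rank_def using fin indep_empty by (intro Max_in) auto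
  then show ?thesis by auto
qed

lemma two_points:
  assumes "X \<subseteq> E" "2 \<le> rank X"
  obtains a b where "a \<in> X" "b \<in> X" "a \<noteq> b"
proof -
  obtain I where "I \<subseteq> X" "2 \<le> card I" using rank_attained assms by metis
  moreover from this obtain J where "J \<subseteq> I" "card J = 2" using obtain_subset_with_card_n by metis
  then obtain a b where "J = {a, b}" "a \<noteq> b" by (auto simp: card_2_iff)
  ultimately show thesis using that \<open>J \<subseteq> I\<close> by blast
qed

text \<open>Adding a collinear point would keep the rank at most 2, so a flat already contains it.
  The image is therefore an entire spanned line, and sizes transfer exactly.\<close>

lemma line_image:
  assumes \<phi>: "inj_on \<phi> E"
    and col: "\<And>T a b. T \<subseteq> E \<Longrightarrow> a \<in> T \<Longrightarrow> b \<in> T \<Longrightarrow> a \<noteq> b \<Longrightarrow>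
      rank T \<le> 2 \<longleftrightarrow> (\<forall>r\<in>T. orient (\<phi> a) (\<phi> b) (\<phi> r) = 0)"
    and L: "line L"
  shows "\<phi> ` L \<in> spanned_lines (\<phi> ` E)"
proof -
  have LE: "L \<subseteq> E" and rL: "rank L = 2" using L by (auto simp: line_def flat_def)
  obtain a b where ab: "a \<in> L" "b \<in> L" "a \<noteq> b" using two_points[OF LE] rL by auto
  have on: "orient (\<phi> a) (\<phi> b) (\<phi> r) = 0" if "r \<in> L" for r
    using col[OF LE ab] rL that by simp
  have "r \<in> L" if r: "r \<in> E" "orient (\<phi> a) (\<phi> b) (\<phi> r) = 0" for r
  proof (rule ccontr)
    assume "r \<notin> L"
    then have "rank (insert r L) > 2" using L rL r(1) by (auto simp: line_def flat_def)
    moreover have "rank (insert r L) \<le> 2"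
      using col[of "insert r L" a b] LE ab r on by auto
    ultimately show False by simp
  qed
  then have "\<phi> ` L = spanned_line (\<phi> ` E) (\<phi> a) (\<phi> b)"
    using on LE by (auto simp: spanned_line_def)
  moreover have "\<phi> a \<noteq> \<phi> b" using \<phi> ab LE by (meson inj_onD subsetD)
  ultimately show ?thesis using ab LE by (auto intro!: spanned_line_in_lines)
qed

lemma realizable_bound:
  assumes real: "realizable" and k: "0 < k"
  shows "int n > int k ^ 2 + int k - 5"
proof -
  obtain \<phi> where \<phi>: "inj_on \<phi> E"
    and "\<forall>T\<subseteq>E. \<forall>a\<in>T. \<forall>b\<in>T. a \<noteq> b \<longrightarrow>
      (rank T \<le> 2 \<longleftrightarrow> (\<forall>r\<in>T. orient (\<phi> a) (\<phi> b) (\<phi> r) = 0))"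
    using realizable_plane_coordinates[OF real] by (elim exE conjE)
  then have col: "rank T \<le> 2 \<longleftrightarrow> (\<forall>r\<in>T. orient (\<phi> a) (\<phi> b) (\<phi> r) = 0)"
    if "T \<subseteq> E" "a \<in> T" "b \<in> T" "a \<noteq> b" for T a b
    using that by simp
  let ?S = "\<phi> ` E"
  let ?K = "{L. line L \<and> card L = k}"
  have card_S: "card ?S = n" using card_image[OF \<phi>] card_ground by simp
  have sub: "L \<subseteq> E" if "L \<in> ?K" for L using that by (auto simp: line_def flat_def)
  obtain a b where ab: "a \<in> E" "b \<in> E" "a \<noteq> b" using two_points[of E] rank_ground by auto
  \<comment> \<open>A single line through all points would force
    \<open>rank E \<le> 2\<close>.\<close>
  have nc: "M \<noteq> ?S" if M: "M \<in> spanned_lines ?S" for M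
  proof
    assume "M = ?S"
    moreover have "\<phi> a \<noteq> \<phi> b" using \<phi> ab by (meson inj_onD)
    ultimately have "?S = spanned_line ?S (\<phi> a) (\<phi> b)"
      using spanned_lines_eq[OF M] ab by auto
    then have "\<forall>r\<in>E. orient (\<phi> a) (\<phi> b) (\<phi> r) = 0" by (auto simp: spanned_line_def)
    then show False using col[of E a b] ab rank_ground by simp
  qed
  have "int (card ?S) > int k ^ 2 + int k - 5"
  proof (rule many_rich_lines_bound)
    show "finite ?S" using finite_ground by simp
    show "\<phi> a \<in> ?S" "\<phi> b \<in> ?S" using ab by auto
    show "\<phi> a \<noteq> \<phi> b" using \<phi> ab by (meson inj_onD)
    show "(`) \<phi> ` ?K \<subseteq> spanned_lines ?S" using line_image[OF \<phi> col] by auto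
    show "card M = k" if "M \<in> (`) \<phi> ` ?K" for M
    proof -
      obtain L where "L \<in> ?K" "M = \<phi> ` L" using \<open>M \<in> (`) \<phi> ` ?K\<close> by blast
      then show ?thesis using card_image[OF inj_on_subset[OF \<phi> sub]] by simp
    qed
    have "inj_on ((`) \<phi>) ?K"
      by (rule inj_on_subset[OF inj_on_image_Pow[OF \<phi>]]) (use sub in auto)
    then show "card ((`) \<phi> ` ?K) = card ?S"
      using card_image[of "(`) \<phi>" ?K] card_full_lines_total[OF k] card_S by simp
  qed (rule nc)
  then show ?thesis using card_S by simp
qed

end

theorem theorem1:
  shows "(\<forall>k n :: nat. 3 \<le> k \<longrightarrow> 0 < n \<longrightarrow>
      (\<exists>(E :: 'a set) indep. nk_configuration E indep n k \<and> matroid.realizable E indep) \<longrightarrow>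
      int n > int k ^ 2 + int k - 5)
    \<and> \<not> (\<exists>(E :: 'a set) indep. nk_configuration E indep 15 4 \<and> matroid.realizable E indep)"
proof -
  have bound: "int n > int k ^ 2 + int k - 5"
    if "0 < k" "nk_configuration E indep n k" "matroid.realizable E indep"
    for k n and E :: "'a set" and indep
    using nk_configuration.realizable_bound[OF that(2,3,1)] .
  \<comment> \<open>For \<open>k = 4\<close> the bound would read 15 > 15.\<close>
  have "\<not> (nk_configuration E indep 15 4 \<and> matroid.realizable E indep)" for E :: "'a set" and indep
    using bound[of 4 E indep 15] by auto
  moreover have "int n > int k ^ 2 + int k - 5"
    if "3 \<le> k" "\<exists>(E :: 'a set) indep. nk_configuration E indep n k \<and> matroid.realizable E indep" for k n
  proof -
    obtain E :: "'a set" and indep where "nk_configuration E indep n k" "matroid.realizable E indep"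
      using \<open>\<exists>(E :: 'a set) indep. nk_configuration E indep n k \<and> matroid.realizable E indep\<close> by blast
    then show ?thesis using bound[of k E indep n] \<open>3 \<le> k\<close> by simp
  qed
  ultimately show ?thesis by blast
qed

end
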